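(* For a positive integer $k$ let $C(k)=\min\left\{\frac{5}{16}k,\ \frac{2}{1+\sqrt{2}}\sqrt{k}\right\}$. If $G$ is a strongly regular graph with diameter $2$ and valency $k$, and $r_j$ ($j=1,2$) denotes the electric resistance between any two vertices of $G$ at distance $j$, then $$\frac{r_2}{r_1}=\frac{\phi_0+\phi_1}{\phi_0}<1+\frac{1}{C(k)} ,$$ where $\phi_0,\phi_1$ are the potentials associated with $G$.
   Context: All graphs are finite, undirected and simple. A connected graph $G$ with diameter $D$ is distance-regular if there are integers $b_i, c_i$ ($0\le i\le D$) such that for any two vertices $x,y$ at graph distance $i$, exactly $c_i$ neighbours of $y$ are at distance $i-1$ from $x$ and exactly $b_i$ neighbours of $y$ are at distance $i+1$ from $x$. Such a graph is regular of valency $k=b_0$. A strongly regular graph with diameter $2$ is a distance-regular graph with $D=2$. Let $n$ be the number of vertices; the potentials are $\phi_0=n-1$ and $\phi_1=\dfrac{c_1\phi_0-k}{b_1}$ (here $c_1=1$). Electric resistance: regard $G$ as an electric circuit in which each edge is a wire of resistance $1$. For distinct vertices $u,v$, let $f$ be a function on the vertices that is harmonic (i.e. $\sum_{x\sim z}(f(x)-f(z))=0$) at every $z\ne u,v$, with $f(u)\neq f(v)$; the resistance between $u$ and $v$ is $\dfrac{f(u)-f(v)}{\sum_{x\sim u}(f(u)-f(x))}$. In a distance-regular graph this depends only on the distance between $u$ and $v$. *)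

theory Defs
  imports Complex_Main "Graph_Theory.Graph_Theory"
begin

text \<open>
  Finite simple graphs are the locale \<^locale>\<open>graph\<close>: finite symmetric digraphs without loops
  and without parallel arcs.  The neighbours of \<open>y\<close> are the \<open>z\<close> with \<open>y \<rightarrow>\<^bsub>G\<^esub> z\<close>.
\<close>

text \<open>
  Shortest-path distance with unit weights. It takes values in the extended reals; in a connected
  graph it is always a natural number.
\<close>

definition gdist :: "('a, 'b) pre_digraph \<Rightarrow> 'a \<Rightarrow> 'a \<Rightarrow> ereal" where
  "gdist G x y = wf_digraph.\<mu> G (\<lambda>_. 1) x y"

definition diameter :: "('a, 'b) pre_digraph \<Rightarrow> ereal" where
  "diameter G = (SUP x\<in>verts G. SUP y\<in>verts G. gdist G x y)"

text \<open>
  No vertex has distance \<open>-1\<close> from \<open>x\<close>, so \<open>c 0 = 0\<close> is forced, as is \<open>b D = 0\<close> for the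
  diameter \<open>D\<close>. The values of \<open>b\<close> and \<open>c\<close> beyond \<open>D\<close> are unconstrained and irrelevant.
\<close>

locale distance_regular_graph = graph G
  for G :: "('a, 'b) pre_digraph" (structure) +
  fixes b c :: "nat \<Rightarrow> nat"
  assumes connected_G: "Digraph_Component.connected G"
    and c_card: "\<And>i x y. \<lbrakk>x \<in> verts G; y \<in> verts G; gdist G x y = ereal (real i)\<rbrakk>
      \<Longrightarrow> card {z. y \<rightarrow>\<^bsub>G\<^esub> z \<and> gdist G x z = ereal (real i - 1)} = c i"
    and b_card: "\<And>i x y. \<lbrakk>x \<in> verts G; y \<in> verts G; gdist G x y = ereal (real i)\<rbrakk>
      \<Longrightarrow> card {z. y \<rightarrow>\<^bsub>G\<^esub> z \<and> gdist G x z = ereal (real i + 1)} = b i"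

locale strongly_regular_graph_diam2 = distance_regular_graph +
  assumes diameter_2: "diameter G = 2"

definition phi0 :: "('a, 'b) pre_digraph \<Rightarrow> real" where
  "phi0 G = real (card (verts G)) - 1"

text \<open>Here \<open>b 0\<close> is the valency.\<close>

definition phi1 :: "('a, 'b) pre_digraph \<Rightarrow> (nat \<Rightarrow> nat) \<Rightarrow> (nat \<Rightarrow> nat) \<Rightarrow> real" where
  "phi1 G b c = (real (c 1) * phi0 G - real (b 0)) / real (b 1)"

definition harmonic_at :: "('a, 'b) pre_digraph \<Rightarrow> ('a \<Rightarrow> real) \<Rightarrow> 'a \<Rightarrow> bool" where
  "harmonic_at G f z \<longleftrightarrow> (\<Sum>x | z \<rightarrow>\<^bsub>G\<^esub> x. f x - f z) = 0"

text \<open>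
  Meaningful for distinct \<open>u\<close> and \<open>v\<close> in a connected graph, where such an \<open>f\<close> exists, the
  denominator is nonzero for every such \<open>f\<close>, and the quotient does not depend on \<open>f\<close>.
\<close>

definition resistance :: "('a, 'b) pre_digraph \<Rightarrow> 'a \<Rightarrow> 'a \<Rightarrow> real" where
  "resistance G u v = (THE r. \<exists>f. (\<forall>z\<in>verts G - {u, v}. harmonic_at G f z) \<and> f u \<noteq> f v \<and>
     r = (f u - f v) / (\<Sum>x | u \<rightarrow>\<^bsub>G\<^esub> x. f u - f x))"

definition C_bound :: "nat \<Rightarrow> real" where
  "C_bound k = min (5 / 16 * real k) (2 / (1 + sqrt 2) * sqrt (real k))"

end

theory Submission
  imports Defs
begin

text \<open>
  Write \<open>k = b 0\<close>. Everything reduces to the two parameters \<open>b 1\<close> and \<open>c 2\<close>, because the ratio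
  of the resistances equals \<open>1 + 1 / (b 1 + c 2)\<close>.

  For the resistances, the potential of a unit source at \<open>u\<close> with a uniformly spread sink is
  radial around \<open>u\<close>: up to scaling it drops by \<open>\<phi>\<^sub>0\<close> along an edge from \<open>u\<close> to its neighbours
  and by \<open>\<phi>\<^sub>1\<close> along an edge from distance \<open>1\<close> to distance \<open>2\<close> (\<open>laplacian_potential\<close>). The
  difference of the potentials around \<open>u\<close> and \<open>v\<close> carries a current from \<open>u\<close> to \<open>v\<close>, with
  voltage \<open>2 \<phi>\<^sub>0\<close> if they are adjacent and \<open>2 (\<phi>\<^sub>0 + \<phi>\<^sub>1)\<close> at distance \<open>2\<close>. By the symmetry of
  the Laplacian, every other flow from \<open>u\<close> to \<open>v\<close> has the same quotient of voltage and
  current, so this one potential computes the resistance (\<open>resistance_eq\<close>).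

  For the inequality, take \<open>x\<close> and \<open>z\<close> at distance \<open>2\<close> and a common neighbour \<open>y\<close>. Each of
  the \<open>k\<close> neighbours of \<open>y\<close> is at distance \<open>2\<close> from \<open>x\<close> (there are \<open>b 1\<close> of these), or at
  distance \<open>2\<close> from \<open>z\<close> (again \<open>b 1\<close>), or a common neighbour of \<open>x\<close> and \<open>z\<close> (at most
  \<open>c 2\<close>). Hence \<open>k \<le> 2 b\<^sub>1 + c\<^sub>2 < 2 (b\<^sub>1 + c\<^sub>2)\<close> (\<open>valency_le\<close>), and
  \<open>C(k) \<le> 5 / 16 k < k / 2 < b\<^sub>1 + c\<^sub>2\<close>.
\<close>

section \<open>Small distances\<close>

context wf_digraph
begin

lemma awalk_cost_one: "awalk_cost (\<lambda>_. 1) p = real (length p)"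
  by (induct p) auto

lemma gdist_le_length:
  assumes "awalk x p y"
  shows "gdist G x y \<le> ereal (real (length p))"
  using min_cost_le_walk_cost[OF assms, of "\<lambda>_. 1"]
  by (simp add: gdist_def awalk_cost_one)

text \<open>With unit weights the costs of walks are natural numbers, so the infimum is a minimum.\<close>

lemma gdist_attained:
  assumes "x \<rightarrow>\<^sup>*\<^bsub>G\<^esub> y"
  obtains p where "awalk x p y" "gdist G x y = ereal (real (length p))"
proof -
  obtain p where p: "awalk x p y" and min: "\<And>q. awalk x q y \<Longrightarrow> length p \<le> length q"
    using assms ex_has_least_nat[of "\<lambda>p. awalk x p y" _ length]
    unfolding reachable_awalk by blast
  have "ereal (real (length p)) \<le> gdist G x y"
    unfolding gdist_def \<mu>_def by (rule INF_greatest) (simp add: awalk_cost_one min)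
  with gdist_le_length[OF p] p that show thesis by auto
qed

lemma gdist_self: "x \<in> verts G \<Longrightarrow> gdist G x x = 0"
  using gdist_le_length[of x "[]" x]
  by (auto simp: awalk_Nil_iff zero_ereal_def intro: gdist_attained[of x x])
 
lemma gdist_ge_1:
  assumes "x \<noteq> y"
  shows "1 \<le> gdist G x y"
proof (cases "x \<rightarrow>\<^sup>*\<^bsub>G\<^esub> y")
  case True
  then obtain p where "awalk x p y" "gdist G x y = ereal (real (length p))"
    by (rule gdist_attained)
  with assms show ?thesis by (cases p) (auto simp: awalk_Nil_iff)
qed (simp add: gdist_def shortest_path_inf)

lemma gdist_adjacent:
  assumes "x \<rightarrow>\<^bsub>G\<^esub> y" "x \<noteq> y"
  shows "gdist G x y = 1"
proof -
  obtain a where a: "a \<in> arcs G" "tail G a = x" "head G a = y"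
    using assms(1) by (auto simp: arcs_ends_conv)
  then have "gdist G x y \<le> 1"
    using gdist_le_length[of x "[a]" y] by (auto simp: awalk_simps one_ereal_def)
  with gdist_ge_1[OF assms(2)] show ?thesis by simp
qed

lemma gdist_ge_2:
  assumes "x \<noteq> y" "\<not> x \<rightarrow>\<^bsub>G\<^esub> y"
  shows "2 \<le> gdist G x y"
proof (cases "x \<rightarrow>\<^sup>*\<^bsub>G\<^esub> y")
  case True
  then obtain p where p: "awalk x p y" "gdist G x y = ereal (real (length p))"
    by (rule gdist_attained)
  show ?thesis
  proof (cases p)
    case Nil
    with p assms show ?thesis by (auto simp: awalk_Nil_iff)
  next
    case (Cons a q)
    with p assms have "q \<noteq> []" by (auto simp: awalk_simps arcs_ends_conv)
    with p Cons show ?thesis by (cases q) auto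
  qed
qed (simp add: gdist_def shortest_path_inf)

lemma gdist_2_common_neighbour:
  assumes "gdist G x y = 2"
  obtains z where "x \<rightarrow>\<^bsub>G\<^esub> z" "z \<rightarrow>\<^bsub>G\<^esub> y"
proof -
  have "x \<rightarrow>\<^sup>*\<^bsub>G\<^esub> y"
    using assms shortest_path_inf[of x y "\<lambda>_. 1"] by (force simp: gdist_def)
  then obtain p where p: "awalk x p y" "gdist G x y = ereal (real (length p))"
    by (rule gdist_attained)
  then have "length p = Suc (Suc 0)"
    using assms by simp
  then obtain a e where "p = [a, e]" by (auto simp: length_Suc_conv)
  with p that show thesis by (auto simp: awalk_simps arcs_ends_conv)
qed

end

section \<open>The Laplacian and resistance\<close>

text \<open>With this sign the value at \<open>u\<close> is the current that leaves \<open>u\<close>, as in the denominator of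
  the resistance.\<close>

definition laplacian :: "('a, 'b) pre_digraph \<Rightarrow> ('a \<Rightarrow> real) \<Rightarrow> 'a \<Rightarrow> real" where
  "laplacian G f z = (\<Sum>x | z \<rightarrow>\<^bsub>G\<^esub> x. f z - f x)"

lemma harmonic_at_iff_laplacian: "harmonic_at G f z \<longleftrightarrow> laplacian G f z = 0"
proof -
  have "laplacian G f z = - (\<Sum>x | z \<rightarrow>\<^bsub>G\<^esub> x. f x - f z)"
    unfolding laplacian_def by (simp flip: sum_negf)
  then show ?thesis by (auto simp: harmonic_at_def)
qed

lemma laplacian_diff:
  "laplacian G (\<lambda>x. f x - g x) z = laplacian G f z - laplacian G g z"
  unfolding laplacian_def by (simp add: algebra_simps flip: sum_subtractf sum.distrib)

context graph
begin

lemma adj_sym: "x \<rightarrow>\<^bsub>G\<^esub> y \<longleftrightarrow> y \<rightarrow>\<^bsub>G\<^esub> x"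
  using sym_arcs by (metis symmetric_def symD)

lemma neighbours_subset: "{z. y \<rightarrow>\<^bsub>G\<^esub> z} \<subseteq> verts G"
  by auto

lemma finite_neighbours: "finite {z. y \<rightarrow>\<^bsub>G\<^esub> z}"
  using neighbours_subset finite_verts by (rule finite_subset)

lemma laplacian_symmetric:
  "(\<Sum>z\<in>verts G. g z * laplacian G f z) = (\<Sum>z\<in>verts G. f z * laplacian G g z)"
proof -
  define A where "A z x = (of_bool (z \<rightarrow>\<^bsub>G\<^esub> x) :: real)" for z x
  have A_sym: "A z x = A x z" for z x
    unfolding A_def using adj_sym[of z x] by simp
  have lap: "laplacian G h z = (\<Sum>x\<in>verts G. A z x * (h z - h x))" for h z
  proof -
    have "(\<Sum>x\<in>verts G. A z x * (h z - h x)) = (\<Sum>x | z \<rightarrow>\<^bsub>G\<^esub> x. A z x * (h z - h x))"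
      using neighbours_subset by (intro sum.mono_neutral_right) (auto simp: A_def)
    then show ?thesis by (simp add: laplacian_def A_def)
  qed
  have expand: "(\<Sum>z\<in>verts G. g z * laplacian G f z)
      = (\<Sum>z\<in>verts G. \<Sum>x\<in>verts G. A z x * g z * f z)
        - (\<Sum>z\<in>verts G. \<Sum>x\<in>verts G. A z x * g z * f x)" for f g
    unfolding lap by (simp add: sum_distrib_left algebra_simps sum_subtractf)
  have "(\<Sum>z\<in>verts G. \<Sum>x\<in>verts G. A z x * g z * f x)
      = (\<Sum>z\<in>verts G. \<Sum>x\<in>verts G. A z x * f z * g x)"
    by (subst sum.swap) (simp add: A_sym mult_ac)
  then show ?thesis unfolding expand by (simp add: mult_ac)
qed

lemma sum_laplacian: "(\<Sum>z\<in>verts G. laplacian G f z) = 0"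
  using laplacian_symmetric[of "\<lambda>_. 1" f] by (simp add: laplacian_def)

lemma sum_two_poles:
  fixes h :: "'a \<Rightarrow> real"
  assumes "u \<in> verts G" "v \<in> verts G" "u \<noteq> v" "\<And>z. z \<in> verts G - {u, v} \<Longrightarrow> h z = 0"
  shows "(\<Sum>z\<in>verts G. h z) = h u + h v"
proof -
  have "(\<Sum>z\<in>verts G. h z) = (\<Sum>z\<in>{u, v}. h z)"
    using assms by (intro sum.mono_neutral_right) auto
  with assms show ?thesis by simp
qed

text \<open>
  One explicit potential determines the resistance. For an arbitrary competitor \<open>f\<close>, pairing
  \<open>f\<close> with the Laplacian of \<open>g\<close> gives \<open>K\<close> times the voltage of \<open>f\<close>; pairing \<open>g\<close> with the
  Laplacian of \<open>f\<close> gives the current of \<open>f\<close> times the voltage of \<open>g\<close>. The two pairings agree,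
  so the ratio of voltage to current is the same for \<open>f\<close> and \<open>g\<close>.
\<close>

lemma resistance_eq:
  assumes uv: "u \<in> verts G" "v \<in> verts G" "u \<noteq> v"
    and g: "\<And>z. z \<in> verts G \<Longrightarrow> laplacian G g z = K * (of_bool (z = u) - of_bool (z = v))"
    and K: "K \<noteq> 0" and ne: "g u \<noteq> g v"
  shows "resistance G u v = (g u - g v) / K"
  unfolding resistance_def
proof (rule the_equality)
  have "(\<Sum>x | u \<rightarrow>\<^bsub>G\<^esub> x. g u - g x) = K"
    using g[of u] uv by (simp add: laplacian_def)
  then show "\<exists>f. (\<forall>z\<in>verts G - {u, v}. harmonic_at G f z) \<and> f u \<noteq> f v \<and>
      (g u - g v) / K = (f u - f v) / (\<Sum>x | u \<rightarrow>\<^bsub>G\<^esub> x. f u - f x)"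
    using g ne by (intro exI[of _ g]) (auto simp: harmonic_at_iff_laplacian)
next
  fix r
  assume "\<exists>f. (\<forall>z\<in>verts G - {u, v}. harmonic_at G f z) \<and> f u \<noteq> f v \<and>
      r = (f u - f v) / (\<Sum>x | u \<rightarrow>\<^bsub>G\<^esub> x. f u - f x)"
  then obtain f where harm: "\<And>z. z \<in> verts G - {u, v} \<Longrightarrow> laplacian G f z = 0"
    and fne: "f u \<noteq> f v" and r: "r = (f u - f v) / laplacian G f u"
    by (auto simp: harmonic_at_iff_laplacian laplacian_def)
  \<comment> \<open>The current that enters at \<open>u\<close> leaves at \<open>v\<close>, as the Laplacian has total zero.\<close>
  have "laplacian G f v = - laplacian G f u"
    using sum_two_poles[OF uv harm] sum_laplacian[of f] by simp
  moreover have "(\<Sum>z\<in>verts G. g z * laplacian G f z)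
      = g u * laplacian G f u + g v * laplacian G f v"
    using harm by (intro sum_two_poles uv) auto
  moreover have "(\<Sum>z\<in>verts G. f z * laplacian G g z)
      = f u * laplacian G g u + f v * laplacian G g v"
    using g by (intro sum_two_poles uv) auto
  ultimately have "laplacian G f u * (g u - g v) = K * (f u - f v)"
    using laplacian_symmetric[of g f] g[of u] g[of v] uv by (simp add: algebra_simps)
  moreover from this have "laplacian G f u \<noteq> 0"
    using K fne by auto
  ultimately show "r = (g u - g v) / K"
    unfolding r using K by (simp add: frac_eq_eq mult.commute)
qed

end

section \<open>Strongly regular graphs\<close>

context strongly_regular_graph_diam2
begin

lemma gdist_le_2:
  assumes "x \<in> verts G" "y \<in> verts G"
  shows "gdist G x y \<le> 2"
proof -
  have "gdist G x y \<le> diameter G"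
    unfolding diameter_def using assms by (meson SUP_upper2 SUP_upper)
  then show ?thesis using diameter_2 by simp
qed

text \<open>Metric conditions become adjacency conditions; the counting below uses only the latter.\<close>

lemma gdist_cases:
  assumes "x \<in> verts G" "y \<in> verts G"
  shows "gdist G x y = (if x = y then 0 else if x \<rightarrow>\<^bsub>G\<^esub> y then 1 else 2)"
  using assms gdist_self gdist_adjacent gdist_ge_2 gdist_le_2 by (auto intro: antisym)

lemma common_neighbour:
  assumes "x \<in> verts G" "y \<in> verts G" "x \<noteq> y" "\<not> x \<rightarrow>\<^bsub>G\<^esub> y"
  obtains z where "x \<rightarrow>\<^bsub>G\<^esub> z" "z \<rightarrow>\<^bsub>G\<^esub> y"
  using gdist_2_common_neighbour gdist_cases assms by metis

lemma nonadjacent_pair_exists: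
  obtains x y where "x \<in> verts G" "y \<in> verts G" "x \<noteq> y" "\<not> x \<rightarrow>\<^bsub>G\<^esub> y"
proof (rule ccontr)
  assume "\<not> thesis"
  then have "x = y \<or> x \<rightarrow>\<^bsub>G\<^esub> y" if "x \<in> verts G" "y \<in> verts G" for x y
    using that \<open>\<And>x y. \<lbrakk>x \<in> verts G; y \<in> verts G; x \<noteq> y; \<not> x \<rightarrow>\<^bsub>G\<^esub> y\<rbrakk> \<Longrightarrow> thesis\<close> by blast
  then have "gdist G x y \<le> 1" if "x \<in> verts G" "y \<in> verts G" for x y
    using that gdist_cases[of x y] by auto
  then have "diameter G \<le> 1"
    unfolding diameter_def by (intro SUP_least)
  then show False using diameter_2 by simp
qed

lemma card_neighbours:
  assumes "x \<in> verts G"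
  shows "card {z. x \<rightarrow>\<^bsub>G\<^esub> z} = b 0"
proof -
  have "{z. x \<rightarrow>\<^bsub>G\<^esub> z} = {z. x \<rightarrow>\<^bsub>G\<^esub> z \<and> gdist G x z = ereal (real 0 + 1)}"
    using gdist_adjacent adj_not_same by (auto simp: one_ereal_def)
  then show ?thesis using b_card[of x x 0] gdist_self[OF assms] assms by simp
qed

lemma c1_eq_1: "c 1 = 1"
proof -
  obtain x y where "x \<in> verts G" "y \<in> verts G" "x \<noteq> y" "\<not> x \<rightarrow>\<^bsub>G\<^esub> y"
    by (rule nonadjacent_pair_exists)
  then obtain z where z: "x \<rightarrow>\<^bsub>G\<^esub> z" "x \<in> verts G" "z \<in> verts G" "x \<noteq> z"
    using common_neighbour by (metis adj_in_verts(2))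
  have "{w. z \<rightarrow>\<^bsub>G\<^esub> w \<and> gdist G x w = ereal (real 1 - 1)} = {x}"
    using z adj_sym gdist_self gdist_ge_1[of x] by force
  moreover have "gdist G x z = ereal (real 1)"
    using gdist_adjacent z by (simp add: one_ereal_def)
  ultimately show ?thesis using c_card[of x z 1] z by simp
qed

lemma card_b1:
  assumes "x \<rightarrow>\<^bsub>G\<^esub> y"
  shows "card {z. y \<rightarrow>\<^bsub>G\<^esub> z \<and> z \<noteq> x \<and> \<not> x \<rightarrow>\<^bsub>G\<^esub> z} = b 1"
proof -
  have xy: "x \<in> verts G" "y \<in> verts G" "x \<noteq> y" using assms adj_not_same by auto
  have "{z. y \<rightarrow>\<^bsub>G\<^esub> z \<and> z \<noteq> x \<and> \<not> x \<rightarrow>\<^bsub>G\<^esub> z}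
      = {z. y \<rightarrow>\<^bsub>G\<^esub> z \<and> gdist G x z = ereal (real 1 + 1)}"
    using xy gdist_cases[of x] by (auto simp: adj_in_verts split: if_splits)
  moreover have "gdist G x y = ereal (real 1)"
    using gdist_adjacent assms xy by (simp add: one_ereal_def)
  ultimately show ?thesis using b_card[of x y 1] xy by simp
qed

lemma card_c2:
  assumes "x \<in> verts G" "y \<in> verts G" "x \<noteq> y" "\<not> x \<rightarrow>\<^bsub>G\<^esub> y"
  shows "card {z. y \<rightarrow>\<^bsub>G\<^esub> z \<and> x \<rightarrow>\<^bsub>G\<^esub> z} = c 2"
proof -
  have "{z. y \<rightarrow>\<^bsub>G\<^esub> z \<and> x \<rightarrow>\<^bsub>G\<^esub> z} = {z. y \<rightarrow>\<^bsub>G\<^esub> z \<and> gdist G x z = ereal (real 2 - 1)}"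
    using assms gdist_cases[of x] adj_not_same by (auto simp: adj_in_verts split: if_splits)
  moreover have "gdist G x y = ereal (real 2)"
    using gdist_cases assms by simp
  ultimately show ?thesis using c_card[of x y 2] assms by simp
qed

lemma parameters_pos: "0 < b 0" "0 < b 1" "0 < c 2"
proof -
  obtain x y where xy: "x \<in> verts G" "y \<in> verts G" "x \<noteq> y" "\<not> x \<rightarrow>\<^bsub>G\<^esub> y"
    by (rule nonadjacent_pair_exists)
  then obtain z where z: "x \<rightarrow>\<^bsub>G\<^esub> z" "z \<rightarrow>\<^bsub>G\<^esub> y"
    by (rule common_neighbour)
  have "z \<in> {w. x \<rightarrow>\<^bsub>G\<^esub> w}" using z by simp
  then show "0 < b 0"
    using card_neighbours[OF xy(1)] finite_neighbours[of x] card_gt_0_iff by force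
  have "y \<in> {w. z \<rightarrow>\<^bsub>G\<^esub> w \<and> w \<noteq> x \<and> \<not> x \<rightarrow>\<^bsub>G\<^esub> w}" using z xy by simp
  moreover have "finite {w. z \<rightarrow>\<^bsub>G\<^esub> w \<and> w \<noteq> x \<and> \<not> x \<rightarrow>\<^bsub>G\<^esub> w}"
    using finite_neighbours[of z] by (rule rev_finite_subset) auto
  ultimately show "0 < b 1"
    using card_b1[OF z(1)] card_gt_0_iff by force
  have "z \<in> {w. y \<rightarrow>\<^bsub>G\<^esub> w \<and> x \<rightarrow>\<^bsub>G\<^esub> w}" using z adj_sym by simp
  moreover have "finite {w. y \<rightarrow>\<^bsub>G\<^esub> w \<and> x \<rightarrow>\<^bsub>G\<^esub> w}"
    using finite_neighbours[of y] by (rule rev_finite_subset) auto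
  ultimately show "0 < c 2"
    using card_c2[OF xy] card_gt_0_iff by force
qed

section \<open>A bound on the valency\<close>

text \<open>
  The neighbours of a vertex \<open>y\<close> that lies between two non-adjacent vertices \<open>x\<close> and \<open>z\<close> are
  covered by the neighbours not joined to \<open>x\<close>, those not joined to \<open>z\<close> and the common neighbours
  of \<open>x\<close> and \<open>z\<close>.
\<close>

lemma valency_le: "b 0 \<le> 2 * b 1 + c 2"
proof -
  obtain x z where xz: "x \<in> verts G" "z \<in> verts G" "x \<noteq> z" "\<not> x \<rightarrow>\<^bsub>G\<^esub> z"
    by (rule nonadjacent_pair_exists)
  then obtain y where y: "x \<rightarrow>\<^bsub>G\<^esub> y" "y \<rightarrow>\<^bsub>G\<^esub> z"
    by (rule common_neighbour)
  define far where "far w = {v. y \<rightarrow>\<^bsub>G\<^esub> v \<and> v \<noteq> w \<and> \<not> w \<rightarrow>\<^bsub>G\<^esub> v}" for w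
  define common where "common = {v. z \<rightarrow>\<^bsub>G\<^esub> v \<and> x \<rightarrow>\<^bsub>G\<^esub> v}"
  have fin: "finite (far w)" "finite common" for w
    unfolding far_def common_def using finite_neighbours
    by (auto intro: rev_finite_subset)
  \<comment> \<open>\<open>far w\<close> leaves out \<open>w\<close> itself, but \<open>x\<close> lies in \<open>far z\<close> and \<open>z\<close> lies in \<open>far x\<close>.\<close>
  have "{v. y \<rightarrow>\<^bsub>G\<^esub> v} \<subseteq> far x \<union> far z \<union> common"
    unfolding far_def common_def using xz adj_sym by auto
  then have "b 0 \<le> card (far x \<union> far z \<union> common)"
    using card_neighbours[of y] y fin by (metis card_mono finite_UnI adj_in_verts(1))
  also have "\<dots> \<le> card (far x) + card (far z) + card common"
    using card_Un_le[of "far x \<union> far z" common] card_Un_le[of "far x" "far z"] by simp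
  also have "\<dots> = 2 * b 1 + c 2"
    unfolding far_def common_def
    using card_b1[OF y(1)] card_b1[of z y] y card_c2[OF xz] adj_sym by simp
  finally show ?thesis .
qed

section \<open>Radial potentials\<close>

definition radial :: "real \<Rightarrow> real \<Rightarrow> real \<Rightarrow> 'a \<Rightarrow> 'a \<Rightarrow> real" where
  "radial p0 p1 p2 u z = (if z = u then p0 else if u \<rightarrow>\<^bsub>G\<^esub> z then p1 else p2)"

text \<open>
  Only edges between different distance classes contribute, and the intersection numbers count
  them.
\<close>

lemma laplacian_radial:
  assumes "u \<in> verts G" "z \<in> verts G"
  shows "laplacian G (radial p0 p1 p2 u) z =
    (if z = u then real (b 0) * (p0 - p1)
     else if u \<rightarrow>\<^bsub>G\<^esub> z then (p1 - p0) + real (b 1) * (p1 - p2)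
     else real (c 2) * (p2 - p1))"
proof -
  have count: "(\<Sum>x | z \<rightarrow>\<^bsub>G\<^esub> x. of_bool (P x)) = real (card {x. z \<rightarrow>\<^bsub>G\<^esub> x \<and> P x})" for P
    by (simp add: finite_neighbours Collect_conj_eq)
  consider "z = u" | "z \<noteq> u" "u \<rightarrow>\<^bsub>G\<^esub> z" | "z \<noteq> u" "\<not> u \<rightarrow>\<^bsub>G\<^esub> z" by blast
  then show ?thesis
  proof cases
    case 1
    have "laplacian G (radial p0 p1 p2 u) z = (\<Sum>x | z \<rightarrow>\<^bsub>G\<^esub> x. p0 - p1)"
      unfolding laplacian_def using 1 adj_not_same
      by (intro sum.cong) (auto simp: radial_def)
    with 1 assms show ?thesis by (simp add: card_neighbours)
  next
    case 2
    have "laplacian G (radial p0 p1 p2 u) z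
        = (\<Sum>x | z \<rightarrow>\<^bsub>G\<^esub> x. (p1 - p0) * of_bool (x = u)
            + (p1 - p2) * of_bool (x \<noteq> u \<and> \<not> u \<rightarrow>\<^bsub>G\<^esub> x))"
      unfolding laplacian_def using 2 by (intro sum.cong) (auto simp: radial_def)
    also have "\<dots> = (p1 - p0) * real (card {x. z \<rightarrow>\<^bsub>G\<^esub> x \<and> x = u})
        + (p1 - p2) * real (card {x. z \<rightarrow>\<^bsub>G\<^esub> x \<and> x \<noteq> u \<and> \<not> u \<rightarrow>\<^bsub>G\<^esub> x})"
      by (simp only: sum.distrib count flip: sum_distrib_left)
    also have "{x. z \<rightarrow>\<^bsub>G\<^esub> x \<and> x = u} = {u}"
      using 2 adj_sym by auto
    finally show ?thesis using 2 card_b1[OF 2(2)] by simp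
  next
    case 3
    have "laplacian G (radial p0 p1 p2 u) z
        = (\<Sum>x | z \<rightarrow>\<^bsub>G\<^esub> x. (p2 - p1) * of_bool (u \<rightarrow>\<^bsub>G\<^esub> x))"
      unfolding laplacian_def using 3 adj_sym[of z u] adj_not_same[of u]
      by (intro sum.cong) (auto simp: radial_def)
    also have "\<dots> = (p2 - p1) * real (card {x. z \<rightarrow>\<^bsub>G\<^esub> x \<and> u \<rightarrow>\<^bsub>G\<^esub> x})"
      by (simp only: count flip: sum_distrib_left)
    finally show ?thesis using 3 assms card_c2[of u z] by simp
  qed
qed

lemma sum_radial:
  assumes "u \<in> verts G"
  shows "(\<Sum>z\<in>verts G. radial p0 p1 p2 u z)
    = p0 + real (b 0) * p1 + (real (card (verts G)) - 1 - real (b 0)) * p2"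
proof -
  have "(\<Sum>z\<in>verts G. radial p0 p1 p2 u z)
      = (\<Sum>z\<in>verts G. p2 + (p0 - p2) * of_bool (z = u) + (p1 - p2) * of_bool (u \<rightarrow>\<^bsub>G\<^esub> z))"
    using adj_not_same by (intro sum.cong) (auto simp: radial_def)
  also have "\<dots> = card (verts G) * p2 + (p0 - p2) * card (verts G \<inter> {z. z = u})
      + (p1 - p2) * card (verts G \<inter> {z. u \<rightarrow>\<^bsub>G\<^esub> z})"
    by (simp add: sum.distrib flip: sum_distrib_left)
  also have "verts G \<inter> {z. z = u} = {u}" using assms by auto
  also have "verts G \<inter> {z. u \<rightarrow>\<^bsub>G\<^esub> z} = {z. u \<rightarrow>\<^bsub>G\<^esub> z}" by auto
  finally show ?thesis using card_neighbours[OF assms] by (simp add: algebra_simps)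
qed

text \<open>
  This is the double count of the edges between the vertices at distance \<open>1\<close> and those at
  distance \<open>2\<close> from a vertex \<open>u\<close>. It appears here as the vanishing of the total Laplacian of the
  indicator function of the vertices at distance \<open>2\<close>.
\<close>

lemma c2_phi1: "c 2 * phi1 G b c = b 0"
proof -
  obtain u where u: "u \<in> verts G" using nonadjacent_pair_exists by blast
  have "0 = (\<Sum>z\<in>verts G. laplacian G (radial 0 0 1 u) z)"
    by (simp add: sum_laplacian)
  also have "\<dots> = (\<Sum>z\<in>verts G. radial 0 (- b 1) (c 2) u z)"
    using u adj_not_same by (intro sum.cong) (auto simp: laplacian_radial radial_def)
  also have "\<dots> = (phi0 G - b 0) * c 2 - b 0 * b 1"
    using u by (simp add: sum_radial phi0_def)
  finally show ?thesis
    using parameters_pos c1_eq_1 by (simp add: phi1_def field_simps)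
qed

lemma phi0_eq: "phi0 G = b 0 + b 1 * phi1 G b c"
  using parameters_pos c1_eq_1 by (simp add: phi1_def field_simps)

lemma phi_pos: "0 < phi0 G" "0 < phi1 G b c"
proof -
  have "phi1 G b c = b 0 / c 2"
    using c2_phi1 parameters_pos by (simp add: field_simps)
  then show "0 < phi1 G b c" using parameters_pos by simp
  then show "0 < phi0 G" using phi0_eq parameters_pos by (simp add: add_pos_pos)
qed

abbreviation potential :: "'a \<Rightarrow> 'a \<Rightarrow> real" where
  "potential \<equiv> radial (phi0 G + phi1 G b c) (phi1 G b c) 0"

text \<open>
  The potentials are chosen so that, away from the source, the Laplacian is constant: at distance
  \<open>1\<close> this is the definition of \<open>\<phi>\<^sub>1\<close>, at distance \<open>2\<close> it is \<open>c2_phi1\<close>.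
\<close>

lemma laplacian_potential:
  assumes "u \<in> verts G" "z \<in> verts G"
  shows "laplacian G (potential u) z = real (b 0) * (real (card (verts G)) * of_bool (z = u) - 1)"
  using assms c2_phi1 phi0_eq
  by (auto simp: laplacian_radial phi0_def algebra_simps)

text \<open>Subtracting two such potentials cancels the uniform sink.\<close>

lemma resistance_potential:
  assumes "u \<in> verts G" "v \<in> verts G" "u \<noteq> v"
  shows "resistance G u v = 2 * (phi0 G + phi1 G b c - potential u v) / (b 0 * card (verts G))"
proof -
  define g where "g x = potential u x - potential v x" for x
  have drop: "g u - g v = 2 * (phi0 G + phi1 G b c - potential u v)"
    using assms adj_sym by (auto simp: g_def radial_def)
  have "laplacian G g z = real (b 0 * card (verts G)) * (of_bool (z = u) - of_bool (z = v))"
    if "z \<in> verts G" for z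
    unfolding g_def laplacian_diff using that assms
    by (simp add: laplacian_potential algebra_simps)
  moreover have "real (b 0 * card (verts G)) \<noteq> 0"
    using parameters_pos assms by auto
  moreover have "potential u v < phi0 G + phi1 G b c"
    using phi_pos assms by (auto simp: radial_def)
  then have "g u \<noteq> g v" using drop by auto
  ultimately show ?thesis
    using resistance_eq[OF assms, of g] drop by metis
qed

lemma resistance_ratio:
  assumes "u \<in> verts G" "v \<in> verts G" "x \<in> verts G" "y \<in> verts G"
    and uv: "gdist G u v = 1" and xy: "gdist G x y = 2"
  shows "resistance G x y / resistance G u v = (phi0 G + phi1 G b c) / phi0 G"
proof -
  have "u \<noteq> v" "u \<rightarrow>\<^bsub>G\<^esub> v" "x \<noteq> y" "\<not> x \<rightarrow>\<^bsub>G\<^esub> y"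
    using assms gdist_cases[of u v] gdist_cases[of x y] by (auto split: if_splits)
  then have "resistance G x y = 2 * (phi0 G + phi1 G b c) / real (b 0 * card (verts G))"
    and "resistance G u v = 2 * phi0 G / real (b 0 * card (verts G))"
    using assms by (simp_all add: resistance_potential radial_def)
  moreover have "real (b 0 * card (verts G)) \<noteq> 0"
    using parameters_pos assms by auto
  ultimately show ?thesis
    using phi_pos by (simp add: frac_eq_eq del: of_nat_mult)
qed

section \<open>The ratio of the potentials\<close>

lemma potential_ratio: "(phi0 G + phi1 G b c) / phi0 G = 1 + 1 / (b 1 + c 2)"
proof -
  have "phi0 G = (b 1 + c 2) * phi1 G b c"
    using phi0_eq c2_phi1 by (simp add: algebra_simps)
  moreover have "0 < real (b 1 + c 2)" using parameters_pos by simp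
  ultimately show ?thesis using phi_pos by (simp add: add_divide_distrib)
qed

lemma C_bound_pos: "0 < C_bound (b 0)"
  using parameters_pos by (simp add: C_bound_def add_pos_pos)

lemma C_bound_less: "C_bound (b 0) < b 1 + c 2"
proof -
  have "C_bound (b 0) \<le> 5 / 16 * real (b 0)"
    by (simp add: C_bound_def)
  also have "\<dots> \<le> 5 / 16 * (2 * b 1 + c 2)"
    using valency_le by simp
  also have "\<dots> < b 1 + c 2"
    using parameters_pos by simp
  finally show ?thesis .
qed

end

theorem corollary3:
  fixes G :: "('a, 'b) pre_digraph" and b c :: "nat \<Rightarrow> nat" and k :: nat
  assumes "strongly_regular_graph_diam2 G b c"
    and "k = b 0"
  shows "(\<forall>u\<in>verts G. \<forall>v\<in>verts G. \<forall>x\<in>verts G. \<forall>y\<in>verts G.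
            gdist G u v = 1 \<longrightarrow> gdist G x y = 2 \<longrightarrow>
            resistance G x y / resistance G u v = (phi0 G + phi1 G b c) / phi0 G)
         \<and> (phi0 G + phi1 G b c) / phi0 G < 1 + 1 / C_bound k"
proof -
  interpret strongly_regular_graph_diam2 G b c by (rule assms(1))
  have "1 / real (b 1 + c 2) < 1 / C_bound k"
    using C_bound_pos C_bound_less assms(2) by (intro divide_strict_left_mono) auto
  then show ?thesis
    using resistance_ratio potential_ratio by simp
qed

end
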